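(* Let $n,w\ge1$ be integers. Let $\mathrm{CDP}(n,w)$ be the set of integer sequences $(a_1,\dots,a_n)$ with $0\le a_i\le w-1$ and $a_{i+1}\le a_i+1$ for all $1\le i\le n$ (where $a_{n+1}:=a_1$), and let $\alpha$ act on $\mathrm{CDP}(n,w)$ by the cyclic shift $(a_1,\dots,a_n)\mapsto(a_n,a_1,\dots,a_{n-1})$, generating a cyclic group $\langle\alpha\rangle$ of order $n$. Let $|\mathrm{CDP}(n,w)|_q=\sum_{(x_0,\mathbf b)}q^{\mathrm{maj}(\mathbf b)}$, summing over all pairs $(x_0,\mathbf b)$ with $x_0\in\{1,\dots,w\}$, $\mathbf b=(b_1,\dots,b_{2n})\in\{0,1\}^{2n}$ having $n$ zeros and $n$ ones and $b_{2n}=1$, such that the lattice path from $(x_0,0)$ taking an east step $(1,0)$ for each $0$ and a north step $(0,1)$ for each $1$ never visits a lattice point on the lines $y=x$ or $y=x-(w+2)$. Then $(\mathrm{CDP}(n,w),\langle\alpha\rangle,|\mathrm{CDP}(n,w)|_q)$ exhibits the cyclic sieving phenomenon.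
   Context: $\mathrm{maj}(\mathbf b)=\sum\{i: b_i>b_{i+1}\}$. A triple $(X,C_n,f(q))$, with $X$ a finite set, $C_n=\langle g\rangle$ a cyclic group of order $n$ acting on $X$, and $f(q)$ a polynomial with non-negative integer coefficients, exhibits the cyclic sieving phenomenon (CSP) if for every $k\in\{1,\dots,n\}$, $f(\omega_n^k)=|\{x\in X: g^k\cdot x=x\}|$, where $\omega_n=e^{2\pi i/n}$ (in particular $f(1)=|X|$). *)

theory Defs
  imports
    "HOL-Algebra.Elementary_Groups"
    "HOL-Algebra.Group_Action"
    "HOL-Computational_Algebra.Polynomial"
    Complex_Main
begin

text \<open>The triple \<open>(X, G, f)\<close> exhibits cyclic sieving, where \<open>G\<close> is a cyclic group of order \<open>n\<close>
  with chosen generator \<open>g\<close>, acting on \<open>X\<close> through \<open>\<phi>\<close>. The action need not be faithful.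
  Non-negativity of the coefficients of \<open>f\<close> is carried by the type \<open>nat poly\<close>.\<close>

definition exhibits_CSP ::
  "'x set \<Rightarrow> ('g, 'm) monoid_scheme \<Rightarrow> nat \<Rightarrow> 'g \<Rightarrow> ('g \<Rightarrow> 'x \<Rightarrow> 'x) \<Rightarrow> nat poly \<Rightarrow> bool"
where
  "exhibits_CSP X G n g \<phi> f \<longleftrightarrow>
     finite X \<and>
     0 < n \<and> Coset.order G = n \<and> g \<in> carrier G \<and> generate G {g} = carrier G \<and>
     group_action G X \<phi> \<and>
     (\<forall>k\<in>{1..n}.
        poly (map_poly of_nat f) (exp (2 * complex_of_real pi * \<i> / of_nat n) ^ k)
          = of_nat (card {x \<in> X. \<phi> (g [^]\<^bsub>G\<^esub> k) x = x}))"

text \<open>The list entry \<open>a ! i\<close> is $a_{i+1}$; the index \<open>Suc i mod n\<close> implements $a_{n+1} := a_1$.\<close>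

definition CDP :: "nat \<Rightarrow> nat \<Rightarrow> int list set" where
  "CDP n w = {a. length a = n \<and>
                 (\<forall>i<n. 0 \<le> a ! i \<and> a ! i \<le> int w - 1) \<and>
                 (\<forall>i<n. a ! (Suc i mod n) \<le> a ! i + 1)}"

definition cyc_shift :: "'a list \<Rightarrow> 'a list" where
  "cyc_shift a = last a # butlast a"

text \<open>The group $C_n$ is \<open>integer_mod_group n\<close> with generator \<open>1 mod int n\<close>, which acts as
  \<open>cyc_shift\<close>. (For \<open>w = 1\<close> the shift is the identity permutation of the set, so $C_n$ cannot be
  taken to be a group of permutations.) The restriction is needed because \<open>group_action\<close> works with
  extensional functions.\<close>

definition CDP_action :: "nat \<Rightarrow> nat \<Rightarrow> int \<Rightarrow> int list \<Rightarrow> int list" where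
  "CDP_action n w k = restrict (cyc_shift ^^ nat k) (CDP n w)"

text \<open>Positions are counted from 1 in the major index, so $b_i > b_{i+1}$ reads
  \<open>b ! (i - 1) > b ! i\<close>.\<close>

definition maj :: "nat list \<Rightarrow> nat" where
  "maj b = \<Sum>{i. 1 \<le> i \<and> i < length b \<and> b ! (i - 1) > b ! i}"

text \<open>The lattice point reached from \<open>(x0, 0)\<close> after \<open>j\<close> steps, 0 being east and 1 north.\<close>

definition path_point :: "int \<Rightarrow> nat list \<Rightarrow> nat \<Rightarrow> int \<times> int" where
  "path_point x0 b j = (x0 + int (count_list (take j b) 0), int (count_list (take j b) 1))"

definition CDP_paths :: "nat \<Rightarrow> nat \<Rightarrow> (int \<times> nat list) set" where
  "CDP_paths n w =
     {(x0, b). x0 \<in> {1..int w} \<and>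
               length b = 2 * n \<and> set b \<subseteq> {0, 1} \<and>
               count_list b 0 = n \<and> count_list b 1 = n \<and> last b = 1 \<and>
               (\<forall>j \<le> 2 * n. \<forall>x y. path_point x0 b j = (x, y) \<longrightarrow>
                   y \<noteq> x \<and> y \<noteq> x - (int w + 2))}"

definition CDP_q :: "nat \<Rightarrow> nat \<Rightarrow> nat poly" where
  "CDP_q n w = (\<Sum>(x0, b) \<in> CDP_paths n w. monom 1 (maj b))"

end

theory Submission
  imports Defs "HOL-Analysis.Complex_Transcendental" "HOL-Library.Groups_Big_Fun"
begin

text \<open>
  The height \<open>x - y\<close> of a path stays between \<open>0\<close> and \<open>L = w + 2\<close>, so the sum of \<open>q ^ maj\<close> over the
  paths starting at \<open>x\<close> is, by a weighted reflection principle, an alternating sum \<open>R x\<close> of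
  Gaussian binomial coefficients. At a root of unity \<open>q\<close> of order \<open>m\<close> with \<open>n = m * d\<close>, the terms
  of \<open>R x\<close> and \<open>R (L - x)\<close> combine in pairs by Pascal's rule, and summing over \<open>x\<close> shows that
  twice the path polynomial is
  $\sum_k {2n \brack n + Lk}_q \sum_{x=0}^{L-1} q^{kx} - \sum_j {2n \brack n+j}_q$, where $k$ and
  $j$ range over all integers. By the \<open>q\<close>-Lucas theorem only the terms with \<open>k\<close> and \<open>j\<close> divisible
  by \<open>m\<close> survive, and they give the same expression for \<open>d\<close> in place of \<open>n\<close> and \<open>1\<close> in place of
  \<open>q\<close>, i.e. the number of paths for \<open>d\<close>. Recording the heights after the north steps, in reverse
  order, identifies the paths for \<open>d\<close> with \<open>CDP d w\<close>, whose elements are exactly the periods of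
  the sequences in \<open>CDP n w\<close> that are fixed by a power of the shift of order \<open>m\<close>.
\<close>

section \<open>Sums over the integers\<close>

lemma Sum_any_reindex_inj:
  assumes "inj h" and "\<And>k. k \<notin> range h \<Longrightarrow> f k = 0"
  shows "Sum_any f = Sum_any (\<lambda>i. f (h i))"
proof -
  have "{k. f k \<noteq> 0} = h ` {i. f (h i) \<noteq> 0}"
    using assms(2) by (auto simp: image_iff) (metis rangeE)
  then show ?thesis
    unfolding Sum_any.expand_set using assms(1) by (simp add: sum.reindex inj_on_subset)
qed

lemma finite_support_mult_comp:
  fixes f :: "'b \<Rightarrow> 'a::mult_zero"
  assumes "finite {a. f a \<noteq> 0}" and "inj h"
  shows "finite {k. c k * f (h k) \<noteq> 0}"
  by (rule finite_subset[OF _ finite_vimageI[OF assms]]) auto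

lemma sum_Sum_any_swap:
  assumes "finite A" and "\<And>x. x \<in> A \<Longrightarrow> finite {k. f x k \<noteq> 0}"
  shows "(\<Sum>x\<in>A. Sum_any (f x)) = Sum_any (\<lambda>k. \<Sum>x\<in>A. f x k)"
  using assms
proof (induction A rule: finite_induct)
  case (insert x A)
  have "{k. (\<Sum>x\<in>A. f x k) \<noteq> 0} \<subseteq> (\<Union>x\<in>A. {k. f x k \<noteq> 0})"
    by (auto elim: sum.not_neutral_contains_not_neutral)
  then have "finite {k. (\<Sum>x\<in>A. f x k) \<noteq> 0}"
    by (rule finite_subset) (use insert in auto)
  with insert show ?case by (simp add: Sum_any.distrib)
qed simp

lemma sum_Sum_any_residues:
  fixes f :: "int \<Rightarrow> 'a::comm_monoid_add"
  assumes "L > 0" and fin: "finite {j. f j \<noteq> 0}"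
  shows "(\<Sum>x<L. Sum_any (\<lambda>k. f (int x + int L * k))) = Sum_any f"
proof -
  have "Sum_any (\<lambda>k. f (int x + int L * k)) = (\<Sum>j | j \<in> {j. f j \<noteq> 0} \<and> nat (j mod int L) = x. f j)"
    if "x < L" for x
  proof -
    have "{j. f j \<noteq> 0 \<and> nat (j mod int L) = x}
        = (\<lambda>k. int x + int L * k) ` {k. f (int x + int L * k) \<noteq> 0}"
    proof (intro Set.equalityI subsetI)
      fix j assume j: "j \<in> {j. f j \<noteq> 0 \<and> nat (j mod int L) = x}"
      then have "j = int x + int L * (j div int L)" using \<open>L > 0\<close> by auto
      with j show "j \<in> (\<lambda>k. int x + int L * k) ` {k. f (int x + int L * k) \<noteq> 0}" by force
    qed (use that in \<open>auto simp: nat_mod_distrib\<close>)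
    then show ?thesis
      unfolding Sum_any.expand_set using \<open>L > 0\<close> by (simp add: sum.reindex inj_on_def)
  qed
  then have "(\<Sum>x<L. Sum_any (\<lambda>k. f (int x + int L * k)))
      = (\<Sum>x<L. \<Sum>j | j \<in> {j. f j \<noteq> 0} \<and> nat (j mod int L) = x. f j)"
    by simp
  also have "\<dots> = Sum_any f"
    unfolding Sum_any.expand_set[of f]
    by (rule sum.group[OF fin]) (use \<open>L > 0\<close> in \<open>auto simp: nat_less_iff\<close>)
  finally show ?thesis .
qed

section \<open>Gaussian binomial coefficients\<close>

fun gauss_binomial :: "'a::field \<Rightarrow> nat \<Rightarrow> int \<Rightarrow> 'a" where
  "gauss_binomial q 0 a = (if a = 0 then 1 else 0)"
| "gauss_binomial q (Suc N) a =
    gauss_binomial q N a + q powi (int (Suc N) - a) * gauss_binomial q N (a - 1)"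

lemma gauss_binomial_eq_0: "a < 0 \<or> a > int N \<Longrightarrow> gauss_binomial q N a = 0"
  by (induction N arbitrary: a) auto

lemma finite_support_gauss_binomial: "finite {a. gauss_binomial q N a \<noteq> 0}"
proof (rule finite_subset)
  show "{a. gauss_binomial q N a \<noteq> 0} \<subseteq> {0..int N}"
    using gauss_binomial_eq_0 by (fastforce simp: not_less[symmetric])
qed simp

lemma gauss_binomial_0_right [simp]: "gauss_binomial q N 0 = 1"
  by (induction N) (simp_all add: gauss_binomial_eq_0)

lemma gauss_binomial_Suc_alt:
  assumes "q \<noteq> 0"
  shows "gauss_binomial q (Suc N) a = q powi a * gauss_binomial q N a + gauss_binomial q N (a - 1)"
proof (induction N arbitrary: a)
  case 0
  then show ?case by auto
next
  case (Suc N)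
  have exponents: "q powi (int (Suc (Suc N)) - a) * q powi (a - 1)
      = q powi a * q powi (int (Suc N) - a)"
    using assms by (simp flip: power_int_add)
  have "gauss_binomial q (Suc (Suc N)) a
      = q powi a * gauss_binomial q N a + gauss_binomial q N (a - 1)
      + (q powi (int (Suc (Suc N)) - a) * q powi (a - 1) * gauss_binomial q N (a - 1)
      + q powi (int (Suc (Suc N)) - a) * gauss_binomial q N (a - 1 - 1))"
    by (subst gauss_binomial.simps(2), subst (1 2) Suc.IH) (simp only: distrib_left mult.assoc)
  also have "\<dots>
      = q powi a * (gauss_binomial q N a + q powi (int (Suc N) - a) * gauss_binomial q N (a - 1))
      + (gauss_binomial q N (a - 1)
        + q powi (int (Suc N) - (a - 1)) * gauss_binomial q N (a - 1 - 1))"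
    unfolding exponents by (simp add: algebra_simps)
  also have "\<dots> = q powi a * gauss_binomial q (Suc N) a + gauss_binomial q (Suc N) (a - 1)"
    by (simp only: gauss_binomial.simps(2))
  finally show ?case .
qed

lemma gauss_binomial_symmetric:
  assumes "q \<noteq> 0"
  shows "gauss_binomial q N (int N - a) = gauss_binomial q N a"
proof (induction N arbitrary: a)
  case (Suc N)
  have "gauss_binomial q (Suc N) (int (Suc N) - a)
      = gauss_binomial q N (int N - (a - 1)) + q powi a * gauss_binomial q N (int N - a)"
    by (simp add: algebra_simps)
  also have "\<dots> = gauss_binomial q N (a - 1) + q powi a * gauss_binomial q N a"
    by (simp only: Suc.IH)
  finally show ?case by (simp only: gauss_binomial_Suc_alt[OF assms] add.commute)
qed auto

text \<open>For \<open>N = 0\<close> the truncated \<open>N - 1\<close> below is harmless: its term is multiplied by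
  \<open>q ^ 0 - 1 = 0\<close>.\<close>

lemma gauss_binomial_absorption:
  assumes "q \<noteq> 0"
  shows "(q powi (int N - a) - 1) * gauss_binomial q N a = (q ^ N - 1) * gauss_binomial q (N - 1) a"
proof (cases N)
  case (Suc M)
  have "q powi (int N - a) * gauss_binomial q N a
      = q powi (int N - a) * q powi a * gauss_binomial q M a
        + q powi (int N - a) * gauss_binomial q M (a - 1)"
    unfolding Suc gauss_binomial_Suc_alt[OF assms] by (simp only: distrib_left mult.assoc)
  also have "q powi (int N - a) * q powi a = q ^ N"
    using assms by (simp flip: power_int_add)
  finally show ?thesis
    using Suc by (simp add: algebra_simps)
qed auto

lemma gauss_binomial_three_term:
  assumes "q \<noteq> 0"
  shows "gauss_binomial q (Suc N) a = gauss_binomial q N a + gauss_binomial q N (a - 1)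
    + (q ^ N - 1) * gauss_binomial q (N - 1) (a - 1)"
  using gauss_binomial_absorption[OF assms, of N "a - 1"] by (simp add: algebra_simps)

section \<open>Gaussian binomial coefficients at roots of unity\<close>

locale primitive_root_of_unity =
  fixes q :: "'a::field" and m :: nat
  assumes order_pos: "0 < m" and power_eq_1_iff: "q ^ i = 1 \<longleftrightarrow> m dvd i"
begin

lemma nonzero: "q \<noteq> 0"
  using power_eq_1_iff[of m] order_pos by (auto simp: power_0_left)

lemma powi_eq_1_iff: "q powi i = 1 \<longleftrightarrow> int m dvd i"
  by (cases i rule: int_cases2) (simp_all add: power_int_minus power_eq_1_iff)

lemma powi_add_order: "q powi (i + int m) = q powi i"
  using powi_eq_1_iff[of "int m"] nonzero by (simp add: power_int_add)

lemma gauss_binomial_order: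
  "gauss_binomial q m a = (if a = 0 then 1 else 0) + (if a = int m then 1 else 0)"
proof -
  consider (outside) "a < 0 \<or> a > int m" | (bottom) "a = 0" | (top) "a = int m"
    | (between) "0 < a" "a < int m" by linarith
  then show ?thesis
  proof cases
    case top
    then show ?thesis
      using gauss_binomial_symmetric[OF nonzero, of m 0] order_pos by simp
  next
    case between
    then have "\<not> int m dvd int m - a" by (simp add: zdvd_not_zless)
    then show ?thesis
      using between gauss_binomial_absorption[OF nonzero, of m a] power_eq_1_iff[of m]
        powi_eq_1_iff[of "int m - a"]
      by simp
  qed (use order_pos in \<open>auto simp: gauss_binomial_eq_0\<close>)
qed

lemma gauss_binomial_add_order:
  "gauss_binomial q (N + m) a = gauss_binomial q N a + gauss_binomial q N (a - int m)"
proof (induction N arbitrary: a)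
  case 0
  show ?case by (simp add: gauss_binomial_order)
next
  case (Suc N)
  define c where "c = q powi (int (Suc N) - a)"
  have exponents: "q powi (int (Suc N + m) - a) = c" "q powi (int (Suc N) - (a - int m)) = c"
    using powi_add_order[of "int (Suc N) - a"] by (simp_all add: c_def algebra_simps)
  have "gauss_binomial q (Suc N + m) a
      = gauss_binomial q (N + m) a
        + q powi (int (Suc N + m) - a) * gauss_binomial q (N + m) (a - 1)"
    by (simp del: of_nat_Suc of_nat_add)
  also have "\<dots> = gauss_binomial q N a + c * gauss_binomial q N (a - 1)
      + (gauss_binomial q N (a - int m) + c * gauss_binomial q N (a - int m - 1))"
    by (simp only: Suc exponents) (simp add: algebra_simps)
  also have "\<dots> = gauss_binomial q (Suc N) a + gauss_binomial q (Suc N) (a - int m)"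
    unfolding gauss_binomial.simps exponents c_def ..
  finally show ?case .
qed

theorem gauss_binomial_mult_order:
  "gauss_binomial q (m * N) a = (if int m dvd a then gauss_binomial 1 N (a div int m) else 0)"
proof (induction N arbitrary: a)
  case 0
  show ?case using order_pos by (auto simp: dvd_div_eq_0_iff)
next
  case (Suc N)
  have "gauss_binomial q (m * Suc N) a
      = gauss_binomial q (m * N) a + gauss_binomial q (m * N) (a - int m)"
    using gauss_binomial_add_order[of "m * N"] by (simp add: add.commute)
  also have "\<dots> = (if int m dvd a then gauss_binomial 1 (Suc N) (a div int m) else 0)"
  proof (cases "int m dvd a")
    case True
    then have "int m dvd a - int m" "(a - int m) div int m = a div int m - 1"
      using order_pos by (auto elim!: dvdE simp: right_diff_distrib[symmetric] algebra_simps)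
    then show ?thesis using True by (simp add: Suc)
  next
    case False
    then have "\<not> int m dvd a - int m" by (simp add: dvd_diff_left_iff)
    with False show ?thesis by (simp add: Suc)
  qed
  finally show ?case .
qed

end

declare gauss_binomial.simps [simp del]

section \<open>The weighted reflection principle\<close>

text \<open>A word is read as a path with steps \<open>+1\<close> for 0 and \<open>-1\<close> for 1 that starts at height \<open>x\<close>,
  and \<open>f a\<close> stands for the sum of \<open>q ^ maj\<close> over the words of length \<open>N\<close> with \<open>a\<close> zeros. The
  terms of \<open>reflected_sum\<close> belong to the images of \<open>x\<close> under the group generated by the
  reflections in \<open>0\<close> and \<open>L\<close>. At height \<open>L\<close> the superposition has to vanish, but appending 0 to a
  word of length \<open>N\<close> that ends in 1 costs \<open>q ^ N\<close>, so at height \<open>0\<close> the condition is that of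
  \<open>reflected_gauss_bottom\<close>. The former makes the weights of the images \<open>s\<close> and \<open>2 * L - s\<close>
  opposite, the latter makes the weight of \<open>-s\<close> equal to \<open>- q powi s\<close> times that of \<open>s\<close>; this
  determines the weights.\<close>

definition image_weight :: "'a::field \<Rightarrow> int \<Rightarrow> int \<Rightarrow> int \<Rightarrow> 'a" where
  "image_weight q L x k = q powi (k * x + L * k * (k - 1))"

definition translates_sum :: "'a::field \<Rightarrow> int \<Rightarrow> int \<Rightarrow> (int \<Rightarrow> 'a) \<Rightarrow> int \<Rightarrow> 'a" where
  "translates_sum q L x f a =
    Sum_any (\<lambda>k. image_weight q L x k * f (a - L * k))"

definition mirrors_sum :: "'a::field \<Rightarrow> int \<Rightarrow> int \<Rightarrow> (int \<Rightarrow> 'a) \<Rightarrow> int \<Rightarrow> 'a" where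
  "mirrors_sum q L x f a =
    Sum_any (\<lambda>k. image_weight q L x k * f (a + x + L * (k - 1)))"

definition reflected_sum :: "'a::field \<Rightarrow> int \<Rightarrow> int \<Rightarrow> (int \<Rightarrow> 'a) \<Rightarrow> int \<Rightarrow> 'a" where
  "reflected_sum q L x f a = translates_sum q L x f a - mirrors_sum q L x f a"

lemmas reflected_sum_defs = reflected_sum_def translates_sum_def mirrors_sum_def

lemma reflected_sum_linear:
  assumes "L \<noteq> 0" and f: "finite {a. f a \<noteq> 0}" and g: "finite {a. g a \<noteq> 0}"
  shows "reflected_sum q L x (\<lambda>a. f a + c * g a) a
    = reflected_sum q L x f a + c * reflected_sum q L x g a"
proof -
  let ?w = "image_weight q L x"
  have linear: "Sum_any (\<lambda>k. ?w k * (f (h k) + c * g (h k)))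
      = Sum_any (\<lambda>k. ?w k * f (h k)) + c * Sum_any (\<lambda>k. ?w k * g (h k))" if "inj h" for h
  proof -
    have fin: "finite {k. ?w k * f (h k) \<noteq> 0}" "finite {k. ?w k * g (h k) \<noteq> 0}"
        "finite {k. c * (?w k * g (h k)) \<noteq> 0}"
      using finite_support_mult_comp[OF f that, of ?w] finite_support_mult_comp[OF g that, of ?w]
        finite_support_mult_comp[OF g that, of "\<lambda>k. c * ?w k"] by (simp_all add: mult.assoc)
    have "Sum_any (\<lambda>k. ?w k * (f (h k) + c * g (h k)))
        = Sum_any (\<lambda>k. ?w k * f (h k) + c * (?w k * g (h k)))"
      by (simp add: algebra_simps)
    then show ?thesis
      using fin by (simp add: Sum_any.distrib Sum_any_right_distrib)
  qed
  have "inj (\<lambda>k. a - L * k)" "inj (\<lambda>k. a + x + L * (k - 1))"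
    using \<open>L \<noteq> 0\<close> by (simp_all add: inj_on_def)
  then show ?thesis
    unfolding reflected_sum_defs by (simp only: linear) (simp add: algebra_simps)
qed

lemma reflected_sum_shift:
  "reflected_sum q L x (\<lambda>a. f (a - 1)) a = reflected_sum q L x f (a - 1)"
  by (simp add: reflected_sum_defs algebra_simps)

abbreviation reflected_gauss :: "'a::field \<Rightarrow> int \<Rightarrow> int \<Rightarrow> nat \<Rightarrow> int \<Rightarrow> 'a" where
  "reflected_gauss q L x N \<equiv> reflected_sum q L x (gauss_binomial q N)"

lemma reflected_gauss_Suc:
  assumes "q \<noteq> 0" and "L \<noteq> 0"
  shows "reflected_gauss q L x (Suc N) a = reflected_gauss q L x N a
    + (reflected_gauss q L x N (a - 1) + (q ^ N - 1) * reflected_gauss q L x (N - 1) (a - 1))"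
proof -
  define f g where "f = gauss_binomial q N" and "g = gauss_binomial q (N - 1)"
  have fin: "finite {a. f a \<noteq> 0}" "finite {a. g a \<noteq> 0}"
    unfolding f_def g_def by (rule finite_support_gauss_binomial)+
  have fin_shift: "finite {a. h (a - 1) \<noteq> 0}" if "finite {a. h a \<noteq> 0}" for h :: "int \<Rightarrow> 'a"
    using finite_support_mult_comp[OF that, of "\<lambda>a. a - 1" "\<lambda>_. 1"] by (simp add: inj_on_def)
  have fin_sum: "finite {a. f a + f (a - 1) \<noteq> 0}"
    by (rule finite_subset[OF _ finite_UnI[OF fin(1) fin_shift[OF fin(1)]]]) auto
  have "gauss_binomial q (Suc N) = (\<lambda>a. f a + f (a - 1) + (q ^ N - 1) * g (a - 1))"
    unfolding f_def g_def by (rule ext) (rule gauss_binomial_three_term[OF assms(1)])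
  then have "reflected_gauss q L x (Suc N) a
      = reflected_sum q L x (\<lambda>a. f a + 1 * f (a - 1)) a
        + (q ^ N - 1) * reflected_sum q L x (\<lambda>a. g (a - 1)) a"
    using reflected_sum_linear[OF assms(2) fin_sum fin_shift[OF fin(2)]] by simp
  also have "\<dots> = reflected_sum q L x f a + 1 * reflected_sum q L x (\<lambda>a. f (a - 1)) a
      + (q ^ N - 1) * reflected_sum q L x (\<lambda>a. g (a - 1)) a"
    by (simp only: reflected_sum_linear[OF assms(2) fin(1) fin_shift[OF fin(1)]])
  finally show ?thesis by (simp add: reflected_sum_shift f_def g_def)
qed

lemma reflected_gauss_top:
  assumes "q \<noteq> 0" and "x + 2 * a - int N = L"
  shows "reflected_gauss q L x N a = 0"
proof -
  have "gauss_binomial q N (a - L * k) = gauss_binomial q N (a + x + L * (k - 1))" for k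
    using gauss_binomial_symmetric[OF assms(1), of N "a + x + L * (k - 1)"]
    by (simp add: assms(2)[symmetric] algebra_simps)
  then show ?thesis by (simp add: reflected_sum_defs)
qed

lemma reflected_gauss_bottom:
  assumes "q \<noteq> 0" and "L \<noteq> 0" and "x + 2 * a = int N"
  shows "reflected_gauss q L x N a + (q ^ N - 1) * reflected_gauss q L x (N - 1) a = 0"
proof -
  define u where "u k = image_weight q L x k *
    (q powi (int N - (a + x + L * (k - 1))) * gauss_binomial q N (a + x + L * (k - 1)))" for k
  have u_Suc: "image_weight q L x k *
      (q powi (int N - (a - L * k)) * gauss_binomial q N (a - L * k))
      = u (k + 1)" for k
  proof -
    have "gauss_binomial q N (a - L * k) = gauss_binomial q N (a + x + L * k)"
      using gauss_binomial_symmetric[OF assms(1), of N "a + x + L * k"]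
      by (simp add: assms(3)[symmetric] algebra_simps)
    moreover have "k * x + L * k * (k - 1) + (int N - (a - L * k))
        = (k + 1) * x + L * (k + 1) * (k + 1 - 1) + (int N - (a + x + L * (k + 1 - 1)))"
      by (simp add: algebra_simps)
    ultimately show ?thesis
      unfolding u_def image_weight_def mult.assoc[symmetric]
        power_int_add[OF disjI1[OF assms(1)], symmetric]
      by (simp only: add_diff_cancel_right')
  qed
  have "(\<lambda>a. q powi (int N - a) * gauss_binomial q N a)
      = (\<lambda>a. gauss_binomial q N a + (q ^ N - 1) * gauss_binomial q (N - 1) a)"
    using gauss_binomial_absorption[OF assms(1), of N] by (simp add: fun_eq_iff algebra_simps)
  then have "reflected_gauss q L x N a + (q ^ N - 1) * reflected_gauss q L x (N - 1) a
      = reflected_sum q L x (\<lambda>a. q powi (int N - a) * gauss_binomial q N a) a"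
    by (simp only: reflected_sum_linear[OF assms(2) finite_support_gauss_binomial
          finite_support_gauss_binomial])
  also have "\<dots> = Sum_any (\<lambda>k. u (k + 1)) - Sum_any u"
    unfolding reflected_sum_defs by (simp only: u_Suc) (simp add: u_def)
  also have "Sum_any (\<lambda>k. u (k + 1)) = Sum_any u"
    by (rule Sum_any_reindex_inj[symmetric]) (auto simp: image_iff intro: exI[of _ "_ - 1"])
  finally show ?thesis by simp
qed

lemma reflected_gauss_0:
  assumes "0 < x" "x < L" "0 < x + 2 * a" "x + 2 * a < L"
  shows "reflected_gauss q L x 0 a = (if a = 0 then 1 else 0)"
proof -
  have "a - L * k = 0 \<longleftrightarrow> k = 0 \<and> a = 0" for k
  proof
    assume "a - L * k = 0"
    then have "L dvd a" by simp
    moreover have "\<not> \<bar>L\<bar> \<le> \<bar>a\<bar>" using assms by linarith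
    ultimately have "a = 0" using dvd_imp_le_int by blast
    with \<open>a - L * k = 0\<close> show "k = 0 \<and> a = 0" using assms by simp
  qed simp
  then have translates: "image_weight q L x k * gauss_binomial q 0 (a - L * k)
      = (if k = 0 then if a = 0 then 1 else 0 else 0)" for k
    by (auto simp: image_weight_def gauss_binomial.simps)
  have "a + x + L * (k - 1) \<noteq> 0" for k
  proof
    assume "a + x + L * (k - 1) = 0"
    then have "a + x = L * (1 - k)" by (simp add: algebra_simps)
    then have "L dvd a + x" by simp
    then show False using zdvd_not_zless[of "a + x" L] assms by linarith
  qed
  then show ?thesis unfolding reflected_sum_defs translates by (simp add: gauss_binomial.simps)
qed

section \<open>Words in a strip\<close>

definition height :: "int \<Rightarrow> nat list \<Rightarrow> int" where
  "height x b = x + int (count_list b 0) - int (count_list b 1)"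

definition step :: "nat \<Rightarrow> int" where
  "step c = (if c = 0 then 1 else if c = 1 then -1 else 0)"

lemma height_snoc: "height x (b @ [c]) = height x b + step c"
  by (simp add: height_def step_def)

lemma height_Cons: "height x (c # b) = height (x + step c) b"
  by (simp add: height_def step_def)

definition inside :: "int \<Rightarrow> int \<Rightarrow> nat list \<Rightarrow> bool" where
  "inside x L b \<longleftrightarrow> (\<forall>j\<le>length b. height x (take j b) \<in> {0<..<L})"

lemma inside_snoc: "inside x L (b @ [c]) \<longleftrightarrow> inside x L b \<and> height x (b @ [c]) \<in> {0<..<L}"
  by (auto simp: inside_def le_Suc_eq all_conj_distrib)

lemma inside_height: "inside x L b \<Longrightarrow> height x b \<in> {0<..<L}"
  by (auto simp: inside_def dest: spec[of _ "length b"])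

lemma count_list_0_add_count_list_1:
  "set b \<subseteq> {0, 1} \<Longrightarrow> count_list b (0::nat) + count_list b 1 = length b"
  by (induction b) auto

lemma maj_snoc: "maj (b @ [c]) = maj b + (if b \<noteq> [] \<and> last b > c then length b else 0)"
proof -
  have "{i. 1 \<le> i \<and> i < length (b @ [c]) \<and> (b @ [c]) ! (i - 1) > (b @ [c]) ! i}
      = {i. 1 \<le> i \<and> i < length b \<and> b ! (i - 1) > b ! i}
        \<union> (if b \<noteq> [] \<and> last b > c then {length b} else {})"
    by (cases "b = []") (auto simp: nth_append last_conv_nth less_Suc_eq split: if_splits)
  then show ?thesis by (auto simp: maj_def)
qed

definition strip_words :: "int \<Rightarrow> int \<Rightarrow> nat \<Rightarrow> int \<Rightarrow> nat list set" where
  "strip_words x L N a =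
    {b. length b = N \<and> set b \<subseteq> {0, 1} \<and> int (count_list b 0) = a \<and> inside x L b}"

lemma finite_strip_words [simp]: "finite (strip_words x L N a)"
proof (rule finite_subset)
  show "strip_words x L N a \<subseteq> {b. set b \<subseteq> {0, 1} \<and> length b = N}" by (auto simp: strip_words_def)
qed (simp add: finite_lists_length_eq)

lemma height_strip_words: "b \<in> strip_words x L N a \<Longrightarrow> height x b = x + 2 * a - int N"
  using count_list_0_add_count_list_1[of b] by (auto simp: strip_words_def height_def)

lemma strip_words_eq_empty: "x + 2 * a - int N \<notin> {0<..<L} \<Longrightarrow> strip_words x L N a = {}"
  using height_strip_words[of _ x L N a] inside_height by (fastforce simp: strip_words_def)

lemma last_strip_words: "b \<in> strip_words x L N a \<Longrightarrow> b = [] \<or> last b = 0 \<or> last b = 1"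
  using last_in_set[of b] unfolding strip_words_def by blast

lemma strip_words_ending:
  assumes "l \<in> {0, 1}" and "x + 2 * a - int (Suc N) \<in> {0<..<L}"
  shows "{b \<in> strip_words x L (Suc N) a. last b = l}
    = (\<lambda>b. b @ [l]) ` strip_words x L N (a + int l - 1)"
    (is "?A = ?f ` ?B")
proof (intro Set.equalityI subsetI)
  fix b assume "b \<in> ?A"
  then have "b \<in> strip_words x L (Suc N) a" "last b = l" by auto
  moreover from this obtain c where "b = c @ [l]"
    by (cases b rule: rev_cases) (auto simp: strip_words_def)
  ultimately show "b \<in> ?f ` ?B"
    using assms(1) by (auto simp: strip_words_def inside_snoc)
next
  fix b assume "b \<in> ?f ` ?B"
  then obtain c where c: "b = c @ [l]" "c \<in> ?B" by auto
  then have "height x b = x + 2 * a - int (Suc N)"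
    using assms(1) height_strip_words[OF c(2)] by (auto simp: height_snoc step_def)
  with assms c show "b \<in> ?A" by (auto simp: strip_words_def inside_snoc)
qed

definition strip_maj_sum :: "'a::field \<Rightarrow> int \<Rightarrow> int \<Rightarrow> nat \<Rightarrow> int \<Rightarrow> 'a" where
  "strip_maj_sum q x L N a = (\<Sum>b\<in>strip_words x L N a. q ^ maj b)"

lemma strip_maj_sum_eq_0: "x + 2 * a - int N \<notin> {0<..<L} \<Longrightarrow> strip_maj_sum q x L N a = 0"
  by (simp add: strip_maj_sum_def strip_words_eq_empty)

lemma strip_maj_sum_0:
  assumes "0 < x" and "x < L"
  shows "strip_maj_sum q x L 0 a = (if a = 0 then 1 else 0)"
proof -
  have "strip_words x L 0 a = (if a = 0 then {[]} else {})"
    using assms by (auto simp: strip_words_def inside_def height_def)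
  then show ?thesis by (simp add: strip_maj_sum_def maj_def)
qed

lemma sum_maj_ending_1:
  assumes "x + 2 * a - int (Suc N) \<in> {0<..<L}"
  shows "(\<Sum>b | b \<in> strip_words x L (Suc N) a \<and> last b = 1. q ^ maj b) = strip_maj_sum q x L N a"
proof -
  have "maj (b @ [1]) = maj b" if "b \<in> strip_words x L N a" for b
    using that last_strip_words[OF that] by (auto simp: maj_snoc)
  then have "(\<Sum>b\<in>(\<lambda>b. b @ [1]) ` strip_words x L N a. q ^ maj b) = strip_maj_sum q x L N a"
    by (subst sum.reindex) (auto simp: inj_on_def strip_maj_sum_def intro!: sum.cong)
  then show ?thesis using strip_words_ending[of 1 x a N L] assms by simp
qed

lemma sum_maj_ending_0:
  assumes "x + 2 * a - int (Suc N) \<in> {0<..<L}"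
  shows "(\<Sum>b | b \<in> strip_words x L (Suc N) a \<and> last b = 0. q ^ maj b)
    = strip_maj_sum q x L N (a - 1)
    + (q ^ N - 1) * (\<Sum>b | b \<in> strip_words x L N (a - 1) \<and> last b = 1. q ^ maj b)"
proof -
  let ?B = "strip_words x L N (a - 1)"
  have summand: "q ^ maj (b @ [0])
      = q ^ maj b + (if last b = 1 then (q ^ N - 1) * q ^ maj b else 0)"
    if "b \<in> ?B" for b
  proof (cases "b = []")
    case True
    with that show ?thesis using maj_snoc[of "[]" 0] by (simp add: strip_words_def)
  next
    case False
    with last_strip_words[OF that] have "last b = 0 \<or> last b = 1" "length b = N"
      using that by (auto simp: strip_words_def)
    with False show ?thesis by (auto simp: maj_snoc power_add algebra_simps)
  qed
  have "(\<Sum>b | b \<in> strip_words x L (Suc N) a \<and> last b = 0. q ^ maj b) = (\<Sum>b\<in>?B. q ^ maj (b @ [0]))"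
    using strip_words_ending[of 0 x a N L] assms by (simp add: sum.reindex inj_on_def)
  also have "\<dots> = strip_maj_sum q x L N (a - 1)
      + (\<Sum>b | b \<in> ?B \<and> last b = 1. (q ^ N - 1) * q ^ maj b)"
    by (simp add: summand sum.distrib strip_maj_sum_def sum.inter_filter cong: sum.cong)
  finally show ?thesis
    by (simp add: sum_distrib_left)
qed

lemma strip_maj_sum_Suc:
  assumes "x + 2 * a - int (Suc N) \<in> {0<..<L}"
  shows "strip_maj_sum q x L (Suc N) a = strip_maj_sum q x L N a + (strip_maj_sum q x L N (a - 1)
    + (if x + 2 * (a - 1) = int N then 0 else (q ^ N - 1) * strip_maj_sum q x L (N - 1) (a - 1)))"
proof -
  have "strip_words x L (Suc N) a = {b \<in> strip_words x L (Suc N) a. last b = 1}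
      \<union> {b \<in> strip_words x L (Suc N) a. last b = 0}"
    using last_strip_words[of _ x L "Suc N" a] unfolding strip_words_def by fastforce
  then have "strip_maj_sum q x L (Suc N) a
      = (\<Sum>b | b \<in> strip_words x L (Suc N) a \<and> last b = 1. q ^ maj b)
      + (\<Sum>b | b \<in> strip_words x L (Suc N) a \<and> last b = 0. q ^ maj b)"
    unfolding strip_maj_sum_def by (subst sum.union_disjoint[symmetric]) auto
  moreover have "(q ^ N - 1) * (\<Sum>b | b \<in> strip_words x L N (a - 1) \<and> last b = 1. q ^ maj b)
      = (if x + 2 * (a - 1) = int N then 0 else (q ^ N - 1) * strip_maj_sum q x L (N - 1) (a - 1))"
  proof (cases "N = 0 \<or> x + 2 * (a - 1) = int N")
    case True
    then show ?thesis using strip_words_eq_empty[of x "a - 1" N L] by auto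
  next
    case False
    then obtain M where "N = Suc M" by (cases N) auto
    then show ?thesis using False assms sum_maj_ending_1[of x "a - 1" M L q] by simp
  qed
  ultimately show ?thesis
    by (simp only: sum_maj_ending_1[OF assms] sum_maj_ending_0[OF assms])
qed

theorem strip_maj_sum_eq_reflected_gauss:
  assumes "q \<noteq> 0" "0 < x" "x < L" and "x + 2 * a - int N \<in> {0<..<L}"
  shows "strip_maj_sum q x L N a = reflected_gauss q L x N a"
  using assms(4)
proof (induction N arbitrary: a rule: less_induct)
  case (less N)
  show ?case
  proof (cases N)
    case 0
    then show ?thesis using less.prems assms by (simp add: strip_maj_sum_0 reflected_gauss_0)
  next
    case (Suc M)
    have up: "strip_maj_sum q x L M a = reflected_gauss q L x M a"
    proof (cases "x + 2 * a - int M = L")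
      case True
      then show ?thesis using assms(1) by (simp add: strip_maj_sum_eq_0 reflected_gauss_top)
    qed (use less Suc in auto)
    have down: "strip_maj_sum q x L M (a - 1)
          + (if x + 2 * (a - 1) = int M then 0
            else (q ^ M - 1) * strip_maj_sum q x L (M - 1) (a - 1))
        = reflected_gauss q L x M (a - 1) + (q ^ M - 1) * reflected_gauss q L x (M - 1) (a - 1)"
    proof (cases "x + 2 * (a - 1) = int M")
      case True
      then show ?thesis
        using assms reflected_gauss_bottom[of q L x "a - 1" M] by (simp add: strip_maj_sum_eq_0)
    next
      case False
      then have "strip_maj_sum q x L M (a - 1) = reflected_gauss q L x M (a - 1)"
        using less Suc by auto
      moreover have "(q ^ M - 1) * strip_maj_sum q x L (M - 1) (a - 1)
          = (q ^ M - 1) * reflected_gauss q L x (M - 1) (a - 1)"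
        using less Suc by (cases M) auto
      ultimately show ?thesis using False by simp
    qed
    show ?thesis
      using less.prems assms unfolding Suc
      by (simp only: strip_maj_sum_Suc up down) (simp add: reflected_gauss_Suc)
  qed
qed

section \<open>Reflected sums at roots of unity\<close>

definition central_gauss :: "'a::field \<Rightarrow> nat \<Rightarrow> int \<Rightarrow> 'a" where
  "central_gauss q n j = gauss_binomial q (2 * n) (int n + j)"

lemma finite_support_central_gauss: "finite {j. central_gauss q n j \<noteq> 0}"
  using finite_support_mult_comp[OF finite_support_gauss_binomial,
      of "\<lambda>j. int n + j" "\<lambda>_. 1" q "2 * n"]
  by (simp add: central_gauss_def)

definition cyclic_reflected_sum :: "'a::field \<Rightarrow> nat \<Rightarrow> nat \<Rightarrow> 'a" where
  "cyclic_reflected_sum q L n =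
    Sum_any (\<lambda>k. central_gauss q n (int L * k) * (\<Sum>x<L. (q powi k) ^ x))
    - Sum_any (central_gauss q n)"

context primitive_root_of_unity
begin

lemma central_gauss_mult_order:
  "central_gauss q (m * d) j = (if int m dvd j then central_gauss 1 d (j div int m) else 0)"
proof -
  have "central_gauss q (m * d) j = gauss_binomial q (m * (2 * d)) (int m * int d + j)"
    by (simp add: central_gauss_def mult_ac)
  moreover have "int m dvd int m * int d + j \<longleftrightarrow> int m dvd j" by (rule dvd_add_right_iff) simp
  ultimately show ?thesis
    using order_pos by (simp add: gauss_binomial_mult_order central_gauss_def)
qed

lemma powi_mult_central_gauss:
  "j dvd i \<Longrightarrow> q powi i * central_gauss q (m * d) j = central_gauss q (m * d) j"
  by (cases "int m dvd j") (auto simp: central_gauss_mult_order powi_eq_1_iff intro: dvd_trans)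

lemma gauss_binomial_reflect:
  assumes "0 < n" and "m dvd n"
  shows "gauss_binomial q (2 * n - 1) (int n - j)
    = central_gauss q n j - q powi j * gauss_binomial q (2 * n - 1) (int n + j)"
proof -
  define N where "N = 2 * n - 1"
  have two_n: "2 * n = Suc N" using assms(1) by (simp add: N_def)
  have "q powi (int n + j) = q powi j"
    using nonzero powi_eq_1_iff[of "int n"] assms(2) by (simp add: power_int_add)
  moreover have "gauss_binomial q N (int n + j - 1) = gauss_binomial q N (int n - j)"
    using gauss_binomial_symmetric[OF nonzero, of N "int n - j"] assms(1)
    by (simp add: N_def algebra_simps)
  ultimately show ?thesis
    unfolding central_gauss_def two_n gauss_binomial_Suc_alt[OF nonzero] by (simp add: N_def)
qed

text \<open>The pairing in the next two lemmas matches the term of index \<open>k\<close> for the starting height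
  \<open>x\<close> with the term of index \<open>-k\<close>, respectively \<open>1 - k\<close>, for \<open>L - x\<close>.\<close>

lemma translates_sum_add_opposite:
  assumes "L \<noteq> 0" and "0 < n" and n_eq: "n = m * d"
  shows "translates_sum q L x (gauss_binomial q (2 * n - 1)) (int n)
    + translates_sum q L (L - x) (gauss_binomial q (2 * n - 1)) (int n)
    = Sum_any (\<lambda>k. q powi (k * x) * central_gauss q n (L * k))"
proof -
  define s where
    "s x k = image_weight q L x k * gauss_binomial q (2 * n - 1) (int n - L * k)" for x k
  have finite_s: "finite {k. s x k \<noteq> 0}" "finite {k. s x (- k) \<noteq> 0}" for x
    unfolding s_def
    by (rule finite_support_mult_comp[OF finite_support_gauss_binomial],
        simp add: assms(1) inj_on_def)+
  have "s x k + s (L - x) (- k) = q powi (k * x) * central_gauss q n (L * k)" for k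
  proof -
    have "s x k = q powi (k * x) * (q powi (L * k * (k - 1)) * central_gauss q n (L * k))
        - image_weight q L x k * q powi (L * k) * gauss_binomial q (2 * n - 1) (int n + L * k)"
      using gauss_binomial_reflect[OF assms(2), of "L * k"] n_eq nonzero
      by (simp add: s_def image_weight_def right_diff_distrib mult.assoc power_int_add)
    also have "q powi (L * k * (k - 1)) * central_gauss q n (L * k) = central_gauss q n (L * k)"
      unfolding n_eq by (rule powi_mult_central_gauss) simp
    also have "image_weight q L x k * q powi (L * k) = image_weight q L (L - x) (- k)"
      using nonzero by (simp flip: power_int_add add: image_weight_def algebra_simps)
    finally show ?thesis by (simp add: s_def)
  qed
  moreover have "Sum_any (s (L - x)) = Sum_any (\<lambda>k. s (L - x) (- k))"
    by (rule Sum_any_reindex_inj) (auto simp: image_iff intro: exI[of _ "- _"])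
  ultimately have "Sum_any (s x) + Sum_any (s (L - x))
      = Sum_any (\<lambda>k. q powi (k * x) * central_gauss q n (L * k))"
    using finite_s by (simp add: Sum_any.distrib[symmetric])
  then show ?thesis by (simp add: translates_sum_def s_def[abs_def])
qed

lemma mirrors_sum_add_opposite:
  assumes "L \<noteq> 0" and "0 < n" and n_eq: "n = m * d"
  shows "mirrors_sum q L x (gauss_binomial q (2 * n - 1)) (int n)
    + mirrors_sum q L (L - x) (gauss_binomial q (2 * n - 1)) (int n)
    = Sum_any (\<lambda>k. central_gauss q n (x + L * k))"
proof -
  define t where
    "t x k = image_weight q L x k * gauss_binomial q (2 * n - 1) (int n + x + L * (k - 1))" for x k
  have finite_t: "finite {k. t x k \<noteq> 0}" "finite {k. t x (1 - k) \<noteq> 0}" for x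
    unfolding t_def
    by (rule finite_support_mult_comp[OF finite_support_gauss_binomial],
        simp add: assms(1) inj_on_def)+
  have "t x k + t (L - x) (1 - k) = central_gauss q n (x + L * (k - 1))" for k
  proof -
    define j where "j = x + L * (k - 1)"
    have "t (L - x) (1 - k) = q powi ((k - 1) * j) * gauss_binomial q (2 * n - 1) (int n - j)"
      by (simp add: t_def image_weight_def j_def algebra_simps)
    also have "\<dots> = q powi ((k - 1) * j) * central_gauss q n j
        - q powi ((k - 1) * j) * q powi j * gauss_binomial q (2 * n - 1) (int n + j)"
      using gauss_binomial_reflect[OF assms(2), of j] n_eq
      by (simp add: right_diff_distrib mult.assoc)
    also have "q powi ((k - 1) * j) * central_gauss q n j = central_gauss q n j"
      unfolding n_eq by (rule powi_mult_central_gauss) simp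
    also have "q powi ((k - 1) * j) * q powi j = q powi (k * j)"
      using nonzero by (simp flip: power_int_add add: algebra_simps)
    also have "q powi (k * j) * gauss_binomial q (2 * n - 1) (int n + j) = t x k"
      by (simp add: t_def image_weight_def j_def algebra_simps)
    finally show ?thesis by (simp add: j_def)
  qed
  moreover have "Sum_any (t (L - x)) = Sum_any (\<lambda>k. t (L - x) (1 - k))"
    by (rule Sum_any_reindex_inj) (auto simp: image_iff inj_on_def intro: exI[of _ "1 - _"])
  ultimately have "Sum_any (t x) + Sum_any (t (L - x))
      = Sum_any (\<lambda>k. central_gauss q n (x + L * (k - 1)))"
    using finite_t by (simp add: Sum_any.distrib[symmetric])
  also have "\<dots> = Sum_any (\<lambda>k. central_gauss q n (x + L * (k + 1 - 1)))"
    by (rule Sum_any_reindex_inj) (auto simp: image_iff inj_on_def intro: exI[of _ "_ - 1"])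
  finally show ?thesis by (simp add: mirrors_sum_def t_def[abs_def])
qed

lemma reflected_gauss_add_opposite:
  assumes "L \<noteq> 0" and "0 < n" and "n = m * d"
  shows "reflected_gauss q L x (2 * n - 1) (int n)
    + reflected_gauss q L (L - x) (2 * n - 1) (int n)
    = Sum_any (\<lambda>k. q powi (k * x) * central_gauss q n (L * k))
    - Sum_any (\<lambda>k. central_gauss q n (x + L * k))"
  using translates_sum_add_opposite[OF assms, of x] mirrors_sum_add_opposite[OF assms, of x]
  by (simp add: reflected_sum_def algebra_simps)

lemma two_times_sum_reflected_gauss:
  assumes "0 < L" and "0 < n" and "n = m * d"
  shows "2 * (\<Sum>x=1..<L. reflected_gauss q (int L) (int x) (2 * n - 1) (int n))
    = cyclic_reflected_sum q L n"
proof -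
  define E where "E = central_gauss q n"
  define A where "A x = Sum_any (\<lambda>k. q powi (k * int x) * E (int L * k))" for x
  define B where "B x = Sum_any (\<lambda>k. E (int x + int L * k))" for x
  let ?R = "\<lambda>x. reflected_gauss q (int L) (int x) (2 * n - 1) (int n)"
  have "(\<Sum>x=1..<L. ?R x) = (\<Sum>x=1..<L. ?R (L - x))"
    by (rule sum.reindex_bij_witness[of _ "\<lambda>x. L - x" "\<lambda>x. L - x"]) auto
  then have "2 * (\<Sum>x=1..<L. ?R x) = (\<Sum>x=1..<L. ?R x + ?R (L - x))"
    by (simp add: sum.distrib)
  also have "\<dots> = (\<Sum>x=1..<L. A x - B x)"
    using reflected_gauss_add_opposite[OF _ assms(2,3), of "int L"] \<open>0 < L\<close>
    by (intro sum.cong refl) (simp add: A_def B_def E_def of_nat_diff)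
  also have "\<dots> = (\<Sum>x<L. A x - B x)"
    using \<open>0 < L\<close> by (simp add: lessThan_atLeast0 sum.atLeast_Suc_lessThan[of 0] A_def B_def)
  also have "\<dots> = (\<Sum>x<L. A x) - (\<Sum>x<L. B x)" by (rule sum_subtractf)
  also have "(\<Sum>x<L. B x) = Sum_any E"
    unfolding B_def E_def using \<open>0 < L\<close> finite_support_central_gauss by (rule sum_Sum_any_residues)
  also have "(\<Sum>x<L. A x) = Sum_any (\<lambda>k. \<Sum>x<L. q powi (k * int x) * E (int L * k))"
    unfolding A_def E_def using \<open>0 < L\<close>
    by (intro sum_Sum_any_swap finite_support_mult_comp[OF finite_support_central_gauss])
      (auto simp: inj_on_def)
  also have "\<dots> = Sum_any (\<lambda>k. E (int L * k) * (\<Sum>x<L. (q powi k) ^ x))"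
    by (simp add: sum_distrib_left power_int_mult mult.commute)
  finally show ?thesis by (simp add: cyclic_reflected_sum_def E_def)
qed

lemma central_gauss_mult_geometric_sum:
  "central_gauss q (m * d) (int L * k) * (\<Sum>x<L. (q powi k) ^ x) =
    (if int m dvd k then central_gauss 1 d (int L * (k div int m)) * of_nat L else 0)"
proof (cases "int m dvd k")
  case True
  then have "q powi k = 1" by (simp add: powi_eq_1_iff)
  with True show ?thesis
    by (simp add: central_gauss_mult_order div_mult_swap)
next
  case False
  have "(\<Sum>x<L. (q powi k) ^ x) = 0" if "int m dvd int L * k"
  proof -
    have "q powi k \<noteq> 1" using False by (simp add: powi_eq_1_iff)
    moreover have "(q powi k) ^ L = 1"
      using that powi_eq_1_iff[of "k * int L"] by (simp add: power_int_mult mult.commute)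
    ultimately show ?thesis by (simp add: geometric_sum)
  qed
  with False show ?thesis by (auto simp: central_gauss_mult_order)
qed

theorem cyclic_reflected_sum_mult_order:
  "cyclic_reflected_sum q L (m * d) = cyclic_reflected_sum 1 L d"
proof -
  have multiples: "Sum_any (\<lambda>k. if int m dvd k then g (k div int m) else 0) = Sum_any g"
    for g :: "int \<Rightarrow> 'a"
  proof -
    have "inj (\<lambda>i. int m * i)" using order_pos by (simp add: inj_on_def)
    then have "Sum_any (\<lambda>k. if int m dvd k then g (k div int m) else 0)
        = Sum_any (\<lambda>i. if int m dvd int m * i then g (int m * i div int m) else 0)"
      by (rule Sum_any_reindex_inj) auto
    then show ?thesis using order_pos by simp
  qed
  have "cyclic_reflected_sum q L (m * d) = Sum_any (\<lambda>k. central_gauss 1 d (int L * k) * of_nat L)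
      - Sum_any (central_gauss 1 d)"
    unfolding cyclic_reflected_sum_def central_gauss_mult_geometric_sum
      multiples[of "\<lambda>i. central_gauss 1 d (int L * i) * of_nat L"]
    unfolding central_gauss_mult_order[abs_def] multiples ..
  then show ?thesis by (simp add: cyclic_reflected_sum_def)
qed

end

section \<open>The path polynomial\<close>

lemma inside_iff_avoids:
  assumes "0 < x" "x < L" and "set b \<subseteq> {0, 1}"
  shows "inside x L b \<longleftrightarrow> (\<forall>j\<le>length b. height x (take j b) \<noteq> 0 \<and> height x (take j b) \<noteq> L)"
  using assms(3)
proof (induction b rule: rev_induct)
  case Nil
  then show ?case using assms by (simp add: inside_def height_def)
next
  case (snoc c b)
  have "(\<forall>j\<le>length (b @ [c]). height x (take j (b @ [c])) \<noteq> 0 \<and> height x (take j (b @ [c])) \<noteq> L)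
      \<longleftrightarrow> inside x L b \<and> height x (b @ [c]) \<noteq> 0 \<and> height x (b @ [c]) \<noteq> L"
    using snoc by (auto simp: le_Suc_eq all_conj_distrib)
  also have "\<dots> \<longleftrightarrow> inside x L (b @ [c])"
    using snoc.prems inside_height[of x L b] unfolding inside_snoc
    by (auto simp: height_snoc step_def)
  finally show ?case ..
qed

lemma CDP_paths_eq_Sigma:
  "CDP_paths n w =
    (SIGMA x:{1..int w}. {b \<in> strip_words x (int w + 2) (2 * n) (int n). last b = 1})"
proof -
  have "(x, b) \<in> CDP_paths n w \<longleftrightarrow>
      x \<in> {1..int w} \<and> b \<in> {b \<in> strip_words x (int w + 2) (2 * n) (int n). last b = 1}" for x b
  proof (cases "x \<in> {1..int w} \<and> set b \<subseteq> {0, 1} \<and> length b = 2 * n \<and> count_list b 0 = n")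
    case True
    have "(\<forall>j\<le>2 * n. \<forall>x' y. path_point x b j = (x', y) \<longrightarrow> y \<noteq> x' \<and> y \<noteq> x' - (int w + 2))
        \<longleftrightarrow> (\<forall>j\<le>length b. height x (take j b) \<noteq> 0 \<and> height x (take j b) \<noteq> int w + 2)"
      using True unfolding path_point_def height_def by (auto simp: algebra_simps)
    also have "\<dots> \<longleftrightarrow> inside x (int w + 2) b"
      using True by (subst inside_iff_avoids) auto
    finally show ?thesis
      using True count_list_0_add_count_list_1[of b] by (auto simp: CDP_paths_def strip_words_def)
  qed (auto simp: CDP_paths_def strip_words_def)
  then show ?thesis by auto
qed

lemma sum_maj_CDP_paths:
  assumes "0 < n" and "q \<noteq> 0"
  shows "(\<Sum>(x, b)\<in>CDP_paths n w. q ^ maj b) =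
    (\<Sum>x=1..<w + 2. reflected_gauss q (int (w + 2)) (int x) (2 * n - 1) (int n))"
proof -
  let ?L = "int (w + 2)" and ?R = "\<lambda>x. reflected_gauss q (int (w + 2)) x (2 * n - 1) (int n)"
  have two_n: "2 * n = Suc (2 * n - 1)" using assms(1) by simp
  have fixed_start: "(\<Sum>b | b \<in> strip_words x ?L (2 * n) (int n) \<and> last b = 1. q ^ maj b) = ?R x"
    if "x \<in> {1..int w}" for x
  proof -
    have "(\<Sum>b | b \<in> strip_words x ?L (2 * n) (int n) \<and> last b = 1. q ^ maj b)
        = strip_maj_sum q x ?L (2 * n - 1) (int n)"
      using that assms(1) by (subst two_n, subst sum_maj_ending_1) auto
    also have "\<dots> = ?R x"
      using that assms by (intro strip_maj_sum_eq_reflected_gauss) auto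
    finally show ?thesis .
  qed
  have "(\<Sum>(x, b)\<in>CDP_paths n w. q ^ maj b)
      = (\<Sum>x\<in>{1..int w}. \<Sum>b | b \<in> strip_words x ?L (2 * n) (int n) \<and> last b = 1. q ^ maj b)"
    unfolding CDP_paths_eq_Sigma by (subst sum.Sigma) (auto simp: add.commute)
  also have "\<dots> = (\<Sum>x\<in>{1..int w}. ?R x)"
    by (rule sum.cong[OF refl fixed_start])
  also have "\<dots> = (\<Sum>x=1..w. ?R (int x))"
    using sum.reindex[of int "{1..w}" ?R] by (simp add: image_int_atLeastAtMost)
  also have "\<dots> = (\<Sum>x=1..<w + 2. ?R (int x))"
  proof -
    have "?R (int (w + 1)) = 0"
      by (rule reflected_gauss_top) (use assms in auto)
    then show ?thesis by (simp flip: atLeastLessThanSuc_atLeastAtMost)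
  qed
  finally show ?thesis .
qed

lemma poly_CDP_q:
  fixes z :: "'a::{comm_semiring_1, semiring_char_0}"
  shows "poly (map_poly of_nat (CDP_q n w)) z = (\<Sum>(x, b)\<in>CDP_paths n w. z ^ maj b)"
proof -
  have "map_poly of_nat (CDP_q n w) = (\<Sum>(x, b)\<in>CDP_paths n w. monom (1::'a) (maj b))"
    by (rule poly_eqI)
      (auto simp: coeff_map_poly CDP_q_def coeff_sum case_prod_beta intro!: sum.cong)
  then show ?thesis by (simp add: poly_sum poly_monom case_prod_beta)
qed

theorem poly_CDP_q_root_of_unity:
  fixes q :: "'a::field_char_0"
  assumes "primitive_root_of_unity q m" and "0 < d"
  shows "poly (map_poly of_nat (CDP_q (m * d) w)) q = of_nat (card (CDP_paths d w))"
proof -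
  interpret q: primitive_root_of_unity q m by (rule assms(1))
  interpret one: primitive_root_of_unity "1 :: 'a" 1 by standard auto
  have "m * d > 0" using q.order_pos assms(2) by simp
  have "2 * (\<Sum>(x, b)\<in>CDP_paths (m * d) w. q ^ maj b) = cyclic_reflected_sum q (w + 2) (m * d)"
    unfolding sum_maj_CDP_paths[OF \<open>m * d > 0\<close> q.nonzero]
    by (rule q.two_times_sum_reflected_gauss) (use \<open>m * d > 0\<close> in auto)
  also have "\<dots> = cyclic_reflected_sum 1 (w + 2) d"
    by (rule q.cyclic_reflected_sum_mult_order)
  also have "\<dots> = 2 * (\<Sum>(x, b)\<in>CDP_paths d w. 1 ^ maj b)"
    unfolding sum_maj_CDP_paths[OF assms(2) one.nonzero]
    by (rule one.two_times_sum_reflected_gauss[symmetric]) (use assms(2) in auto)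
  finally show ?thesis by (simp add: poly_CDP_q case_prod_beta)
qed

section \<open>Paths and cyclic sequences\<close>

fun north_heights :: "int \<Rightarrow> nat list \<Rightarrow> int list" where
  "north_heights x [] = []"
| "north_heights x (c # b) =
    (if c = 0 then north_heights (x + 1) b else (x - 1) # north_heights (x - 1) b)"

fun path_of_heights :: "int \<Rightarrow> int list \<Rightarrow> nat list" where
  "path_of_heights x [] = []"
| "path_of_heights x (h # hs) = replicate (nat (h + 1 - x)) 0 @ 1 # path_of_heights h hs"

lemma north_heights_neq_Nil: "b \<noteq> [] \<Longrightarrow> last b = 1 \<Longrightarrow> north_heights x b \<noteq> []"
  by (induction x b rule: north_heights.induct) (auto split: if_splits)

lemma length_north_heights: "set b \<subseteq> {0, 1} \<Longrightarrow> length (north_heights x b) = count_list b 1"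
  by (induction x b rule: north_heights.induct) auto

lemma last_north_heights:
  "set b \<subseteq> {0, 1} \<Longrightarrow> b = [] \<or> last b = 1 \<Longrightarrow> last (x # north_heights x b) = height x b"
proof (induction x b rule: north_heights.induct)
  case (2 x c b)
  then show ?case
    using north_heights_neq_Nil[of b "x + 1"] by (cases "b = []") (auto simp: height_def)
qed (simp add: height_def)

lemma successively_north_heights: "successively (\<lambda>x y. x \<le> y + 1) (x # north_heights x b)"
  by (induction x b rule: north_heights.induct) (auto simp: successively_Cons)

lemma north_heights_Cons_obtain:
  assumes "b \<noteq> []" and "last b = 1"
  obtains h hs where "north_heights x b = h # hs" and "x \<le> h + 1"
  using north_heights_neq_Nil[OF assms, of x] successively_north_heights[of x b]
  by (cases "north_heights x b") auto

lemma path_of_heights_north_heights: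
  "set b \<subseteq> {0, 1} \<Longrightarrow> b = [] \<or> last b = 1 \<Longrightarrow> path_of_heights x (north_heights x b) = b"
proof (induction x b rule: north_heights.induct)
  case (2 x c b)
  show ?case
  proof (cases "c = 0")
    case True
    with "2.prems" have "b \<noteq> []" "last b = 1" by (auto split: if_splits)
    then obtain h hs where heights: "north_heights (x + 1) b = h # hs" and "x + 1 \<le> h + 1"
      by (rule north_heights_Cons_obtain)
    then have "nat (h + 1 - x) = Suc (nat (h + 1 - (x + 1)))" by simp
    then show ?thesis using True heights "2.IH"(1) "2.prems" \<open>last b = 1\<close> by simp
  next
    case False
    with "2.prems" have "c = 1" "b = [] \<or> last b = 1" by (auto split: if_splits)
    then show ?thesis using "2.IH"(2) "2.prems" by simp
  qed
qed simp

lemma north_heights_replicate_0: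
  "north_heights x (replicate k 0 @ b) = north_heights (x + int k) b"
  by (induction k arbitrary: x) (auto simp: add_ac)

lemma north_heights_path_of_heights:
  "successively (\<lambda>x y. x \<le> y + 1) (x # hs) \<Longrightarrow> north_heights x (path_of_heights x hs) = hs"
  by (induction x hs rule: path_of_heights.induct) (auto simp: north_heights_replicate_0)

lemma set_path_of_heights: "set (path_of_heights x hs) \<subseteq> {0, 1}"
  by (induction x hs rule: path_of_heights.induct) auto

lemma last_path_of_heights: "hs \<noteq> [] \<Longrightarrow> last (path_of_heights x hs) = 1"
proof (induction x hs rule: path_of_heights.induct)
  case (2 x h hs)
  then show ?case by (cases hs) auto
qed simp

lemma inside_Cons: "inside x L (c # b) \<longleftrightarrow> x \<in> {0<..<L} \<and> inside (x + step c) L b"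
proof -
  have "inside x L (c # b) \<longleftrightarrow> x \<in> {0<..<L} \<and> (\<forall>j\<le>length b. height x (c # take j b) \<in> {0<..<L})"
    unfolding inside_def less_Suc_eq_le[symmetric] by (simp add: All_less_Suc2 height_def)
  then show ?thesis by (simp add: height_Cons inside_def)
qed

lemma inside_iff_north_heights:
  "set b \<subseteq> {0, 1} \<Longrightarrow> b = [] \<or> last b = 1 \<Longrightarrow> x \<in> {0<..<w + 2} \<Longrightarrow>
    inside x (w + 2) b \<longleftrightarrow> set (north_heights x b) \<subseteq> {1..w}"
proof (induction x b rule: north_heights.induct)
  case (1 x)
  then show ?case by (simp add: inside_def height_def)
next
  case (2 x c b)
  have start_inside: "y \<in> {0<..<w + 2}" if "inside y (w + 2) b" for y
    using that by (auto simp: inside_def height_def dest: spec[of _ 0])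
  show ?case
  proof (cases "c = 0")
    case True
    with "2.prems" have "b \<noteq> []" "last b = 1" by (auto split: if_splits)
    then obtain h hs where "north_heights (x + 1) b = h # hs" and "x + 1 \<le> h + 1"
      by (rule north_heights_Cons_obtain)
    then have "x + 1 \<in> {0<..<w + 2}" if "set (north_heights (x + 1) b) \<subseteq> {1..w}"
      using that "2.prems" by auto
    with True show ?thesis
      using "2.IH"(1) "2.prems" \<open>last b = 1\<close> start_inside[of "x + 1"]
      by (auto simp: inside_Cons step_def)
  next
    case False
    with "2.prems" have "c = 1" "b = [] \<or> last b = 1" by (auto split: if_splits)
    then show ?thesis
      using "2.IH"(2) "2.prems" start_inside[of "x - 1"] by (auto simp: inside_Cons step_def)
  qed
qed

definition closed_height_lists :: "nat \<Rightarrow> nat \<Rightarrow> int list set" where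
  "closed_height_lists n w = {hs. length hs = n \<and> set hs \<subseteq> {1..int w} \<and>
    successively (\<lambda>x y. x \<le> y + 1) (last hs # hs)}"

lemma north_heights_CDP_paths:
  assumes "0 < n" and "(x, b) \<in> CDP_paths n w"
  shows "last (north_heights x b) = x" and "path_of_heights x (north_heights x b) = b"
    and "north_heights x b \<in> closed_height_lists n w"
proof -
  have start: "x \<in> {1..int w}"
    and word: "set b \<subseteq> {0, 1}" "last b = 1" "length b = 2 * n" "count_list b 0 = n"
    and "inside x (int w + 2) b"
    using assms(2) by (auto simp: CDP_paths_eq_Sigma strip_words_def)
  then have range: "set (north_heights x b) \<subseteq> {1..int w}"
    using inside_iff_north_heights[of b x "int w"] by simp
  have count: "count_list b 1 = n" using word count_list_0_add_count_list_1[of b] by simp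
  then have length_eq: "length (north_heights x b) = n"
    using word by (simp add: length_north_heights)
  then have "north_heights x b \<noteq> []" using assms(1) by auto
  then show last_eq: "last (north_heights x b) = x"
    using last_north_heights[of b x] word count by (simp add: height_def)
  show "path_of_heights x (north_heights x b) = b"
    using word by (simp add: path_of_heights_north_heights)
  show "north_heights x b \<in> closed_height_lists n w"
    using range length_eq last_eq successively_north_heights[of x b]
    by (simp add: closed_height_lists_def)
qed

lemma path_of_heights_in_CDP_paths:
  assumes "0 < n" and "hs \<in> closed_height_lists n w"
  shows "(last hs, path_of_heights (last hs) hs) \<in> CDP_paths n w"
proof -
  let ?x = "last hs" and ?b = "path_of_heights (last hs) hs"
  have closed: "length hs = n" "set hs \<subseteq> {1..int w}" "successively (\<lambda>x y. x \<le> y + 1) (?x # hs)"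
    using assms(2) by (simp_all add: closed_height_lists_def)
  have "hs \<noteq> []" using closed(1) assms(1) by auto
  then have start: "?x \<in> {1..int w}" and ends_in_1: "last ?b = 1"
    using closed(2) last_in_set[of hs] last_path_of_heights[of hs] by blast+
  have heights: "north_heights ?x ?b = hs" by (rule north_heights_path_of_heights[OF closed(3)])
  have "count_list ?b 1 = n"
    using length_north_heights[OF set_path_of_heights, of ?x ?x hs] heights closed(1) by simp
  moreover have "height ?x ?b = ?x"
    using last_north_heights[OF set_path_of_heights, of ?x hs ?x] ends_in_1 heights \<open>hs \<noteq> []\<close>
    by simp
  ultimately have count: "count_list ?b 0 = n" "length ?b = 2 * n"
    using count_list_0_add_count_list_1[OF set_path_of_heights, of ?x hs]
    by (simp_all add: height_def)
  have "inside ?x (int w + 2) ?b"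
    using inside_iff_north_heights[OF set_path_of_heights, of ?x hs ?x "int w"] ends_in_1 heights
      closed(2) start by simp
  then show ?thesis
    using start ends_in_1 count set_path_of_heights
    by (simp add: CDP_paths_eq_Sigma strip_words_def)
qed

lemma bij_betw_north_heights:
  assumes "0 < n"
  shows "bij_betw (\<lambda>(x, b). north_heights x b) (CDP_paths n w) (closed_height_lists n w)"
proof (rule bij_betw_byWitness[where f' = "\<lambda>hs. (last hs, path_of_heights (last hs) hs)"])
  show "\<forall>hs\<in>closed_height_lists n w.
      (case (last hs, path_of_heights (last hs) hs) of (x, b) \<Rightarrow> north_heights x b) = hs"
    by (auto simp: closed_height_lists_def north_heights_path_of_heights)
qed (use assms north_heights_CDP_paths path_of_heights_in_CDP_paths in auto)

lemma CDP_iff_successively: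
  assumes "0 < n"
  shows "a \<in> CDP n w \<longleftrightarrow> length a = n \<and> set a \<subseteq> {0..int w - 1} \<and>
    successively (\<lambda>x y. y \<le> x + 1) (a @ [hd a])"
proof (cases "length a = n")
  case True
  then have "a \<noteq> []" using assms by auto
  then have "(a @ [hd a]) ! i = a ! i" "(a @ [hd a]) ! Suc i = a ! (Suc i mod n)" if "i < n" for i
    using that True by (cases "Suc i = n"; simp add: nth_append hd_conv_nth)+
  then have "successively (\<lambda>x y. y \<le> x + 1) (a @ [hd a]) \<longleftrightarrow> (\<forall>i<n. a ! (Suc i mod n) \<le> a ! i + 1)"
    using True by (simp add: successively_conv_nth)
  moreover have "(\<forall>i<n. 0 \<le> a ! i \<and> a ! i \<le> int w - 1) \<longleftrightarrow> set a \<subseteq> {0..int w - 1}"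
    using True by (auto simp: set_conv_nth)
  ultimately show ?thesis using True by (simp add: CDP_def)
qed (simp add: CDP_def)

lemma bij_betw_CDP_closed_height_lists:
  assumes "0 < n"
  shows "bij_betw (\<lambda>a. map (\<lambda>x. x + 1) (rev a)) (CDP n w) (closed_height_lists n w)"
proof -
  let ?f = "\<lambda>a :: int list. map (\<lambda>x. x + 1) (rev a)"
  have CDP_iff: "a \<in> CDP n w \<longleftrightarrow> ?f a \<in> closed_height_lists n w" for a
  proof (cases "length a = n")
    case True
    then have "a \<noteq> []" using assms by auto
    then have "last (?f a) # ?f a = ?f (a @ [hd a])"
      by (simp add: last_map last_rev)
    then have "successively (\<lambda>x y. x \<le> y + 1) (last (?f a) # ?f a)
        \<longleftrightarrow> successively (\<lambda>x y. y \<le> x + 1) (a @ [hd a])"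
      by (simp only: successively_map successively_rev add_le_cancel_right)
    moreover have "set (?f a) \<subseteq> {1..int w} \<longleftrightarrow> set a \<subseteq> {0..int w - 1}" by auto
    ultimately show ?thesis
      using True by (simp only: CDP_iff_successively[OF assms] closed_height_lists_def
          mem_Collect_eq length_map length_rev)
  qed (simp add: CDP_def closed_height_lists_def)
  show ?thesis
  proof (rule bij_betw_byWitness[where f' = "\<lambda>hs. rev (map (\<lambda>x. x - 1) hs)"])
    show "(\<lambda>hs. rev (map (\<lambda>x. x - 1) hs)) ` closed_height_lists n w \<subseteq> CDP n w"
      unfolding image_subset_iff CDP_iff by (simp add: comp_def)
    show "?f ` CDP n w \<subseteq> closed_height_lists n w"
      unfolding image_subset_iff using CDP_iff by blast
  qed (simp_all add: comp_def rev_map)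
qed

theorem card_CDP_eq_card_CDP_paths: "0 < n \<Longrightarrow> card (CDP n w) = card (CDP_paths n w)"
  using bij_betw_CDP_closed_height_lists bij_betw_north_heights by (metis bij_betw_same_card)

section \<open>Rotations and periods of lists\<close>

lemma rotate_mult_fixed: "rotate k xs = xs \<Longrightarrow> rotate (k * t) xs = xs"
  by (induction t) (auto simp: rotate_rotate[symmetric])

lemma rotate_gcd_fixed:
  assumes "rotate k xs = xs"
  shows "rotate (gcd k (length xs)) xs = xs"
proof (cases "k = 0")
  case False
  then obtain x y where xy: "k * x = length xs * y + gcd k (length xs)"
    using bezout_nat[of k "length xs"] by auto
  have "rotate (gcd k (length xs)) xs = rotate (k * x) xs"
    unfolding xy by (subst (1 2) rotate_conv_mod) simp
  then show ?thesis using rotate_mult_fixed[OF assms] by simp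
qed simp

definition periodic_list :: "nat \<Rightarrow> 'a list \<Rightarrow> bool" where
  "periodic_list d xs \<longleftrightarrow> (\<forall>i<length xs. xs ! i = xs ! (i mod d))"

theorem rotate_fixed_iff_periodic:
  "rotate k xs = xs \<longleftrightarrow> periodic_list (gcd k (length xs)) xs"
proof
  let ?d = "gcd k (length xs)"
  assume "rotate k xs = xs"
  then have fixed: "rotate (?d * t) xs = xs" for t
    by (intro rotate_mult_fixed rotate_gcd_fixed)
  have "xs ! i = xs ! (i mod ?d)" if "i < length xs" for i
  proof -
    have "i mod ?d < length xs" using that by (meson le_less_trans mod_less_eq_dividend)
    then have "rotate (?d * (i div ?d)) xs ! (i mod ?d)
        = xs ! ((?d * (i div ?d) + i mod ?d) mod length xs)"
      by (rule nth_rotate)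
    then show ?thesis using fixed that by simp
  qed
  then show "periodic_list ?d xs" by (simp add: periodic_list_def)
next
  let ?d = "gcd k (length xs)"
  assume periodic: "periodic_list ?d xs"
  show "rotate k xs = xs"
  proof (rule nth_equalityI)
    fix i assume "i < length (rotate k xs)"
    then have i: "i < length xs" by simp
    then have "(k + i) mod length xs < length xs" by (intro mod_less_divisor) auto
    moreover have "(k + i) mod length xs mod ?d = (k + i) mod ?d" by (simp add: mod_mod_cancel)
    moreover have "(k + i) mod ?d = i mod ?d"
      using mod_add_left_eq[of k ?d i] by simp
    ultimately have "xs ! ((k + i) mod length xs) = xs ! (i mod ?d)"
      using periodic unfolding periodic_list_def by metis
    then show "rotate k xs ! i = xs ! i"
      using periodic i by (simp add: nth_rotate periodic_list_def)
  qed simp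
qed

definition extend_periodically :: "nat \<Rightarrow> 'a list \<Rightarrow> 'a list" where
  "extend_periodically n xs = map (\<lambda>i. xs ! (i mod length xs)) [0..<n]"

lemma extend_periodically_take:
  assumes "periodic_list d xs" and "0 < d" "d \<le> length xs"
  shows "extend_periodically (length xs) (take d xs) = xs"
  using assms by (intro nth_equalityI) (simp_all add: extend_periodically_def periodic_list_def)

lemma take_extend_periodically:
  "length xs \<le> n \<Longrightarrow> take (length xs) (extend_periodically n xs) = xs"
  by (intro nth_equalityI) (auto simp: extend_periodically_def)

lemma periodic_list_extend_periodically:
  "xs \<noteq> [] \<Longrightarrow> periodic_list (length xs) (extend_periodically n xs)"
  by (simp add: periodic_list_def extend_periodically_def le_less_trans[OF mod_less_eq_dividend])

lemma CDP_iff_take_CDP: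
  assumes "0 < n" "d dvd n" and len: "length a = n" and periodic: "periodic_list d a"
  shows "a \<in> CDP n w \<longleftrightarrow> take d a \<in> CDP d w"
proof -
  have "0 < d" "d \<le> n" using assms(1,2) by (auto intro: dvd_pos_nat dvd_imp_le)
  have nth: "a ! i = a ! (i mod d)" if "i < n" for i
    using periodic that len by (simp add: periodic_list_def)
  have nth_Suc: "a ! (Suc i mod n) = a ! (Suc (i mod d) mod d)" for i
    using nth[of "Suc i mod n"] assms(1,2) by (simp add: mod_mod_cancel mod_Suc_eq)
  have residues: "(\<forall>i<n. P (i mod d)) \<longleftrightarrow> (\<forall>i<d. P i)" for P
    using \<open>0 < d\<close> \<open>d \<le> n\<close> by (metis mod_less mod_less_divisor order_less_le_trans)
  have "a \<in> CDP n w \<longleftrightarrow> (\<forall>i<n. 0 \<le> a ! (i mod d) \<and> a ! (i mod d) \<le> int w - 1)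
      \<and> (\<forall>i<n. a ! (Suc (i mod d) mod d) \<le> a ! (i mod d) + 1)"
    using len nth nth_Suc by (simp add: CDP_def)
  also have "\<dots> \<longleftrightarrow> (\<forall>i<d. 0 \<le> a ! i \<and> a ! i \<le> int w - 1) \<and> (\<forall>i<d. a ! (Suc i mod d) \<le> a ! i + 1)"
    using residues[of "\<lambda>i. 0 \<le> a ! i \<and> a ! i \<le> int w - 1"]
      residues[of "\<lambda>i. a ! (Suc i mod d) \<le> a ! i + 1"]
    by blast
  also have "\<dots> \<longleftrightarrow> take d a \<in> CDP d w"
    using len \<open>0 < d\<close> \<open>d \<le> n\<close> by (simp add: CDP_def)
  finally show ?thesis .
qed

theorem card_periodic_CDP:
  assumes "0 < n" and "d dvd n"
  shows "card {a \<in> CDP n w. periodic_list d a} = card (CDP d w)"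
proof -
  have d_bounds: "0 < d" "d \<le> n" using assms by (auto intro: dvd_pos_nat dvd_imp_le)
  have length_eq: "length a = n" if "a \<in> CDP n w" for a n using that by (simp add: CDP_def)
  have "bij_betw (take d) {a \<in> CDP n w. periodic_list d a} (CDP d w)"
  proof (rule bij_betw_byWitness[where f' = "extend_periodically n"])
    show "\<forall>a\<in>{a \<in> CDP n w. periodic_list d a}. extend_periodically n (take d a) = a"
      using d_bounds length_eq extend_periodically_take by blast
    show take_extend: "\<forall>b\<in>CDP d w. take d (extend_periodically n b) = b"
      using d_bounds length_eq take_extend_periodically by blast
    show "take d ` {a \<in> CDP n w. periodic_list d a} \<subseteq> CDP d w"
      using CDP_iff_take_CDP[OF assms length_eq] by blast
    show "extend_periodically n ` CDP d w \<subseteq> {a \<in> CDP n w. periodic_list d a}"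
    proof (intro image_subsetI CollectI conjI)
      fix b assume b: "b \<in> CDP d w"
      then have "b \<noteq> []" using d_bounds length_eq[OF b] by auto
      then show periodic: "periodic_list d (extend_periodically n b)"
        using periodic_list_extend_periodically[of b n] length_eq[OF b] by simp
      have "length (extend_periodically n b) = n" by (simp add: extend_periodically_def)
      then show "extend_periodically n b \<in> CDP n w"
        using CDP_iff_take_CDP[OF assms _ periodic] take_extend b by simp
    qed
  qed
  then show ?thesis by (rule bij_betw_same_card)
qed

section \<open>The cyclic shift\<close>

lemma cyc_shift_funpow_eq_rev_rotate:
  assumes "a \<noteq> []"
  shows "(cyc_shift ^^ k) a = rev (rotate k (rev a))"
proof (induction k)
  case (Suc k)
  have "cyc_shift b = rev (rotate1 (rev b))" if "b \<noteq> []" for b :: "'a list"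
    using that by (cases b rule: rev_cases) (simp_all add: cyc_shift_def)
  then show ?case using Suc assms by simp
qed simp

lemma cyc_shift_funpow_eq_rotate:
  "a \<noteq> [] \<Longrightarrow> (cyc_shift ^^ k) a = rotate (length a - k mod length a) a"
  by (simp add: cyc_shift_funpow_eq_rev_rotate rotate_rev)

lemma cyc_shift_funpow_fixed_iff_periodic:
  assumes "a \<noteq> []"
  shows "(cyc_shift ^^ k) a = a \<longleftrightarrow> periodic_list (gcd k (length a)) a"
proof -
  have "gcd (length a - k mod length a) (length a) = gcd (k mod length a) (length a)"
    using assms by (intro gcd_diff2_nat) (simp add: less_imp_le)
  also have "\<dots> = gcd k (length a)" by (metis gcd.commute gcd_red_nat)
  finally have "gcd (length a - k mod length a) (length a) = gcd k (length a)" .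
  then show ?thesis
    using assms by (simp add: cyc_shift_funpow_eq_rotate rotate_fixed_iff_periodic)
qed

lemma finite_CDP: "finite (CDP n w)"
proof (rule finite_subset)
  show "CDP n w \<subseteq> {a. set a \<subseteq> {0..int w - 1} \<and> length a = n}"
    by (auto simp: CDP_def in_set_conv_nth)
qed (simp add: finite_lists_length_eq)

lemma cyc_shift_funpow_CDP:
  assumes "0 < n" and "a \<in> CDP n w"
  shows "(cyc_shift ^^ k) a \<in> CDP n w"
proof (induction k)
  case (Suc k)
  have "cyc_shift b \<in> CDP n w" if "b \<in> CDP n w" for b
  proof -
    from that assms(1) obtain bs x where b: "b = bs @ [x]"
      by (cases b rule: rev_cases) (auto simp: CDP_def)
    from that show ?thesis
      unfolding CDP_iff_successively[OF assms(1)] b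
      by (cases bs) (auto simp: cyc_shift_def successively_append_iff successively_Cons hd_append)
  qed
  with Suc show ?case by simp
qed (use assms in simp)

lemma bij_betw_cyc_shift_funpow_CDP:
  assumes "0 < n"
  shows "bij_betw (cyc_shift ^^ k) (CDP n w) (CDP n w)"
proof -
  have "inj (rotate k :: int list \<Rightarrow> int list)"
    unfolding rotate_def using inj_rotate1 by (rule inj_fn)
  moreover have "[] \<notin> CDP n w" using assms by (simp add: CDP_def)
  ultimately have "inj_on (cyc_shift ^^ k) (CDP n w)"
    by (intro inj_onI) (metis cyc_shift_funpow_eq_rev_rotate injD rev_is_rev_conv)
  moreover have "(cyc_shift ^^ k) ` CDP n w \<subseteq> CDP n w"
    using cyc_shift_funpow_CDP[OF assms] by blast
  ultimately show ?thesis
    by (simp add: bij_betw_def endo_inj_surj finite_CDP)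
qed

lemma cyc_shift_funpow_mod_length:
  assumes "a \<noteq> []"
  shows "(cyc_shift ^^ (k mod length a)) a = (cyc_shift ^^ k) a"
  using assms by (simp add: cyc_shift_funpow_eq_rotate)

lemma CDP_action_mod:
  assumes "0 < n" and "0 \<le> k" and "a \<in> CDP n w"
  shows "CDP_action n w (k mod int n) a = (cyc_shift ^^ nat k) a"
proof -
  have "a \<noteq> []" "length a = n" using assms by (auto simp: CDP_def)
  then show ?thesis
    using assms cyc_shift_funpow_mod_length[of a "nat k"]
    by (simp add: CDP_action_def nat_mod_distrib)
qed

lemma group_action_CDP:
  assumes "0 < n"
  shows "group_action (integer_mod_group n) (CDP n w) (CDP_action n w)"
proof -
  have "CDP_action n w k \<in> Bij (CDP n w)" for k
    using bij_betw_cyc_shift_funpow_CDP[OF assms]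
    by (simp add: Bij_def CDP_action_def bij_betw_restrict_eq)
  moreover have "CDP_action n w ((x + y) mod int n)
      = compose (CDP n w) (CDP_action n w x) (CDP_action n w y)" if "0 \<le> x" "0 \<le> y" for x y
  proof
    fix a
    show "CDP_action n w ((x + y) mod int n) a
        = compose (CDP n w) (CDP_action n w x) (CDP_action n w y) a"
    proof (cases "a \<in> CDP n w")
      case True
      then have "CDP_action n w ((x + y) mod int n) a = (cyc_shift ^^ nat (x + y)) a"
        using assms that by (simp add: CDP_action_mod)
      with True show ?thesis
        using that cyc_shift_funpow_CDP[OF assms]
        by (simp add: CDP_action_def compose_def nat_add_distrib funpow_add)
    qed (simp add: CDP_action_def compose_def)
  qed
  ultimately have "CDP_action n w \<in> hom (integer_mod_group n) (BijGroup (CDP n w))"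
    using assms by (auto simp: hom_def BijGroup_def carrier_integer_mod_group)
  then show ?thesis
    by (simp add: group_action_def group_hom_def group_hom_axioms_def group_BijGroup)
qed

lemma generate_integer_mod_group:
  assumes "0 < n"
  shows "generate (integer_mod_group n) {1 mod int n} = carrier (integer_mod_group n)"
proof -
  have "1 mod int n \<in> carrier (integer_mod_group n)"
    using assms by (simp add: carrier_integer_mod_group)
  then have "generate (integer_mod_group n) {1 mod int n}
      = {k * (1 mod int n) mod int n | k. k \<in> (UNIV :: int set)}"
    by (subst group.generate_pow) (auto simp: int_pow_integer_mod_group)
  also have "\<dots> = carrier (integer_mod_group n)"
  proof (intro Set.equalityI subsetI)
    fix x assume "x \<in> carrier (integer_mod_group n)"
    then have "x = x * (1 mod int n) mod int n"
      using assms by (simp add: carrier_integer_mod_group mod_simps)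
    then show "x \<in> {k * (1 mod int n) mod int n | k. k \<in> (UNIV :: int set)}" by blast
  qed (use assms in \<open>auto simp: carrier_integer_mod_group\<close>)
  finally show ?thesis .
qed

section \<open>Cyclic sieving\<close>

lemma card_CDP_action_fixed:
  assumes "0 < n"
  shows "card {a \<in> CDP n w. CDP_action n w ((1 mod int n) [^]\<^bsub>integer_mod_group n\<^esub> k) a = a}
    = card (CDP (gcd k n) w)"
proof -
  have "CDP_action n w ((1 mod int n) [^]\<^bsub>integer_mod_group n\<^esub> k) a = a \<longleftrightarrow> periodic_list (gcd k n) a"
    if "a \<in> CDP n w" for a
  proof -
    have "a \<noteq> []" "length a = n" using that assms by (auto simp: CDP_def)
    then show ?thesis
      using that assms cyc_shift_funpow_fixed_iff_periodic[of a k] CDP_action_mod[of n "int k" a w]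
      by (simp add: mod_simps)
  qed
  then have "{a \<in> CDP n w. CDP_action n w ((1 mod int n) [^]\<^bsub>integer_mod_group n\<^esub> k) a = a}
      = {a \<in> CDP n w. periodic_list (gcd k n) a}" by blast
  then show ?thesis using card_periodic_CDP[OF assms, of "gcd k n"] by simp
qed

lemma primitive_root_of_unity_exp:
  assumes "0 < n"
  shows "primitive_root_of_unity (exp (2 * complex_of_real pi * \<i> / of_nat n) ^ k) (n div gcd k n)"
proof
  let ?q = "exp (2 * complex_of_real pi * \<i> / of_nat n) ^ k"
  show "0 < n div gcd k n" using assms by (simp add: div_greater_zero_iff gcd_le2_nat)
  fix j
  have "?q ^ j = exp (2 * complex_of_real pi * \<i> * of_nat (k * j) / of_nat n)"
    by (simp flip: exp_of_nat_mult power_mult add: field_simps)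
  then have "?q ^ j = 1 \<longleftrightarrow> n dvd k * j"
    using complex_root_unity_eq_1[of n "k * j"] assms by simp
  also have "\<dots> \<longleftrightarrow> gcd k n * (n div gcd k n) dvd gcd k n * (k div gcd k n * j)"
    by (simp add: mult.assoc[symmetric])
  also have "\<dots> \<longleftrightarrow> n div gcd k n dvd k div gcd k n * j"
    using assms by (intro dvd_times_left_cancel_iff) simp
  also have "\<dots> \<longleftrightarrow> n div gcd k n dvd j"
    using div_gcd_coprime[of k n] assms
    by (intro coprime_dvd_mult_right_iff) (simp add: coprime_commute)
  finally show "?q ^ j = 1 \<longleftrightarrow> n div gcd k n dvd j" .
qed

theorem theorem4p1:
  fixes n w :: nat
  assumes "n \<ge> 1" and "w \<ge> 1"
  shows "exhibits_CSP (CDP n w) (integer_mod_group n) n (1 mod int n) (CDP_action n w) (CDP_q n w)"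
proof -
  have n_pos: "0 < n" using assms(1) by simp
  have "poly (map_poly of_nat (CDP_q n w)) (exp (2 * complex_of_real pi * \<i> / of_nat n) ^ k)
      = of_nat (card {a \<in> CDP n w. CDP_action n w ((1 mod int n) [^]\<^bsub>integer_mod_group n\<^esub> k) a = a})"
    for k
  proof -
    have gcd: "0 < gcd k n" "n div gcd k n * gcd k n = n" using n_pos by auto
    have "poly (map_poly of_nat (CDP_q n w)) (exp (2 * complex_of_real pi * \<i> / of_nat n) ^ k)
        = of_nat (card (CDP_paths (gcd k n) w))"
      using poly_CDP_q_root_of_unity[OF primitive_root_of_unity_exp[OF n_pos, of k] gcd(1)]
      by (simp only: gcd(2))
    then show ?thesis
      by (simp only: card_CDP_action_fixed[OF n_pos] card_CDP_eq_card_CDP_paths[OF gcd(1)])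
  qed
  then show ?thesis
    unfolding exhibits_CSP_def
    using n_pos finite_CDP group_action_CDP generate_integer_mod_group
    by (simp add: Coset.order_def carrier_integer_mod_group)
qed

end
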